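(* Fix a positive integer $n$. A set of primes with exactly two elements admits a 4-cycle if any of the following hold: (1) it is of the form $\{p,p+2\}$ with $p$ and $p+2$ both prime; (2) it is of the form $\{p,p^n-2\}$ with $p$ and $p^n-2$ both prime; (3) it is of the form $\{p,2p+1\}$ with $p$ and $2p+1$ both prime.
   Context: A set of primes $\{p_1,\dots,p_k\}$ is said to admit a 4-cycle if there exist signs $\epsilon_1,\epsilon_2,\epsilon_3,\epsilon_4\in\{-1,1\}$ and integers $u_i=p_1^{a_{i1}}\cdots p_k^{a_{ik}}$ ($1\le i\le 4$), with every $a_{ij}$ a nonnegative integer, such that $\epsilon_1u_1+\epsilon_2u_2+\epsilon_3u_3+\epsilon_4u_4=0$ and no proper nonempty subsum vanishes (i.e. $\sum_{i\in I}\epsilon_iu_i\neq 0$ for every $\emptyset\ne I\subsetneq\{1,2,3,4\}$). The $u_i$ need not be distinct. *)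

theory Defs
  imports "HOL-Computational_Algebra.Primes"
begin

text \<open>
  Working over \<^typ>\<open>int\<close> keeps the signed sums and differences such as \<open>p ^ n - 2\<close> free of
  truncation. The library predicate \<^const>\<open>prime\<close> on \<^typ>\<open>int\<close> holds of the positive primes only.
\<close>

definition admits_four_cycle :: "int set \<Rightarrow> bool" where
  "admits_four_cycle S \<longleftrightarrow>
     finite S \<and> (\<forall>p\<in>S. prime p) \<and>
     (\<exists>(\<epsilon> :: nat \<Rightarrow> int) (u :: nat \<Rightarrow> int) (a :: nat \<Rightarrow> int \<Rightarrow> nat).
        (\<forall>i\<in>{1..4}. \<epsilon> i \<in> {-1, 1}) \<and>
        (\<forall>i\<in>{1..4}. u i = (\<Prod>p\<in>S. p ^ a i p)) \<and>
        (\<Sum>i\<in>{1..4}. \<epsilon> i * u i) = 0 \<and>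
        (\<forall>I. I \<noteq> {} \<and> I \<subset> {1..4} \<longrightarrow> (\<Sum>i\<in>I. \<epsilon> i * u i) \<noteq> 0))"

end

theory Submission
  imports Defs
begin

text \<open>
  If one positive integer is the sum of three others, then the corresponding signed relation has
  no vanishing proper subsum, for reasons of sign alone. The three families are therefore covered by
  \<open>p + 2 = p + 1 + 1\<close>, \<open>p ^ n = (p ^ n - 2) + 1 + 1\<close> and \<open>2 * p + 1 = p + p + 1\<close>.
\<close>

text \<open>Index 1 carries the isolated larger term and gets sign +1, the others -1;
  \<open>a\<close> and \<open>b\<close> hold the exponents of \<open>p\<close> and \<open>q\<close>,
  so each family only has to supply exponents.\<close>

lemma admits_four_cycle_pairI:
  fixes p q :: int and a b :: "nat \<Rightarrow> nat"
  assumes "prime p" "prime q" "p \<noteq> q"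
    and eq: "p ^ a 1 * q ^ b 1 = p ^ a 2 * q ^ b 2 + p ^ a 3 * q ^ b 3 + p ^ a 4 * q ^ b 4"
  shows "admits_four_cycle {p, q}"
proof -
  define u where "u i = p ^ a i * q ^ b i" for i
  define \<epsilon> :: "nat \<Rightarrow> int" where "\<epsilon> i = (if i = 1 then 1 else -1)" for i
  have pos: "u i > 0" for i
    using assms(1,2) by (simp add: u_def prime_gt_0_int)
  have range: "{1..4} = {1, 2, 3, 4::nat}"
    by auto
  have total: "(\<Sum>i\<in>{1..4}. \<epsilon> i * u i) = 0"
    using eq unfolding range by (simp add: \<epsilon>_def u_def)
  have neg: "(\<Sum>i\<in>J. \<epsilon> i * u i) < 0" if "finite J" "J \<noteq> {}" "1 \<notin> J" for J
  proof -
    have "(\<Sum>i\<in>J. \<epsilon> i * u i) = - (\<Sum>i\<in>J. u i)"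
      using that(3) by (auto simp: \<epsilon>_def simp flip: sum_negf intro!: sum.cong)
    then show ?thesis
      using sum_pos[of J u] that(1,2) pos by simp
  qed
  have proper: "(\<Sum>i\<in>I. \<epsilon> i * u i) \<noteq> 0" if "I \<noteq> {}" "I \<subset> {1..4}" for I
  proof (cases "1 \<in> I")
    case True
    \<comment> \<open>The complement of \<open>I\<close> omits index 1 and is nonempty as
      \<open>I\<close> is proper. Since the total is 0, a negative sum there forces a positive sum
      over \<open>I\<close>.\<close>
    have "(\<Sum>i\<in>{1..4} - I. \<epsilon> i * u i) < 0"
      using that True by (intro neg) auto
    then show ?thesis
      using total that(2) by (simp add: sum_diff)
  next
    case False
    have "finite I"
      using that(2) finite_subset by blast
    then show ?thesis
      using neg[of I] that(1) False by simp
  qed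
  \<comment> \<open>Both exponent functions merge into one indexed by the prime;
    \<open>p \<noteq> q\<close> makes the product have two factors.\<close>
  have "u i = (\<Prod>r\<in>{p, q}. r ^ (if r = p then a i else b i))" for i
    using \<open>p \<noteq> q\<close> by (simp add: u_def)
  moreover have "\<epsilon> i \<in> {-1, 1}" for i
    by (simp add: \<epsilon>_def)
  ultimately show ?thesis
    unfolding admits_four_cycle_def using assms(1,2) total proper
    by (intro conjI exI[of _ \<epsilon>] exI[of _ u]
        exI[of _ "\<lambda>i r. if r = p then a i else b i"]) auto
qed

theorem theorem1p5:
  fixes n :: nat and S :: "int set"
  assumes "n \<ge> 1"
    and "\<forall>q\<in>S. prime q"
    and "card S = 2"
    and "(\<exists>p. prime p \<and> prime (p + 2) \<and> S = {p, p + 2}) \<or>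
         (\<exists>p. prime p \<and> prime (p ^ n - 2) \<and> S = {p, p ^ n - 2}) \<or>
         (\<exists>p. prime p \<and> prime (2 * p + 1) \<and> S = {p, 2 * p + 1})"
  shows "admits_four_cycle S"
proof -
  \<comment> \<open>The cardinality excludes the collapse \<open>p ^ n - 2 = p\<close>, which occurs
    for \<open>p = 2\<close>, \<open>n = 2\<close>.\<close>
  have distinct: "p \<noteq> q" if "S = {p, q}" for p q
    using assms(3) that by auto
  from assms(4) show ?thesis
  proof (elim disjE exE conjE)
    fix p assume "prime p" "prime (p + 2)" "S = {p, p + 2}"
    then show ?thesis
      using admits_four_cycle_pairI
          [of p "p + 2" "\<lambda>i. if i = 2 then 1 else 0" "\<lambda>i. if i = 1 then 1 else 0"]
      by simp
  next
    fix p assume "prime p" "prime (p ^ n - 2)" and S: "S = {p, p ^ n - 2}"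
    then show ?thesis
      \<comment> \<open>Here the power of \<open>p\<close> is the isolated term; zero exponents at
        indices 3 and 4 give the two summands 1.\<close>
      using distinct[OF S] admits_four_cycle_pairI
          [of p "p ^ n - 2" "\<lambda>i. if i = 1 then n else 0" "\<lambda>i. if i = 2 then 1 else 0"]
      by simp
  next
    fix p assume "prime p" "prime (2 * p + 1)" and S: "S = {p, 2 * p + 1}"
    then show ?thesis
      using distinct[OF S] admits_four_cycle_pairI
          [of p "2 * p + 1" "\<lambda>i. if i = 2 \<or> i = 3 then 1 else 0" "\<lambda>i. if i = 1 then 1 else 0"]
      by simp
  qed
qed

end
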